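(* Let $X$ be a Markov chain satisfying the standing assumptions and let Assumption $\mathbf L(V,\varphi,\Psi)$ hold with level $\ell_0\in[1,\infty)$ (both stated in the context). Fix $q\in(0,1)$. Let $h:[1,\infty)\to[1,\infty)$ be continuous and non-decreasing on $[\ell_0',\infty)\subseteq[\ell_0,\infty)$, let $G_h(r):=q(1-q)h(r)/(r\varphi(1/r))$, $r\in[1,\infty)$, and let $G_h^{-1}:[G_h(\ell_0'),\infty)\to\mathbb R_+$ be the inverse of $G_h$. Then for every $\ell\in[\ell_0',\infty)$ with $\ell>\ell_0$ and every $B\in\mathcal B(\mathcal X)$ with $B\subset\{V\le\ell\}$ the following holds: for every $m\in(0,\infty)$, with $C_{\ell,m}$ the constant in Assumption $\mathbf L(V,\varphi,\Psi)$(ii), and every $x\in\mathcal X$, $$\mathbb P_x\Big(\sum_{k=0}^{\tau_B(1)}h\circ V(X_k)\ge r\Big)\ \ge\ \frac{q\,C_{\ell,m}\,P(x,\{V\ge\ell+m\})}{\Psi\big(G_h^{-1}(r)/(1-q)^2\big)}\qquad\text{for all } r\in(G_h(\ell+m),\infty).$$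
   Context: $\mathbb N=\{0,1,\dots\}$, $\mathbb R_+=[0,\infty)$. Standing assumptions. $X=(X_n)_{n\in\mathbb N}$ is a Markov chain on a locally compact topological space $\mathcal X$ with Borel $\sigma$-algebra $\mathcal B(\mathcal X)$ and transition kernel $P$; $P^n(x,A)=\mathbb P_x(X_n\in A)$; $Pf(x)=\int f(y)P(x,\mathrm dy)$. $X$ is aperiodic, irreducible, positive Harris recurrent and Feller (for every $n$ and open $O$, $x\mapsto P^n(x,O)$ is lower semicontinuous), and ergodic with invariant distribution $\pi$, i.e. $\|P^n(x,\cdot)-\pi\|_{\mathrm{TV}}\to0$ for all $x$. Assumption $\mathbf L(V,\varphi,\Psi)$. $V:\mathcal X\to[1,\infty)$ is continuous and $\limsup_{n\to\infty}V(X_n)=\infty$ $\mathbb P_x$-a.s. for all $x$. There is $\ell_0\in[1,\infty)$ such that: (i) $\varphi:(0,1]\to\mathbb R_+$ is continuous, $r\mapsto r\varphi(1/r)$ is (strictly) decreasing on $[1,\infty)$, $\lim_{r\to\infty}r\varphi(1/r)=0$, and for some $b\in\mathbb R_+$: $P(1/V)-\varphi(1/V)\le 1/V+b\,\mathbf 1\{V\le\ell_0\}$ on $\mathcal X$. (ii) $\Psi:[1,\infty)\to[1,\infty)$ is differentiable, increasing and submultiplicative (for some $C\in(0,\infty)$, $\Psi(r_1+r_2)\le C\Psi(r_1)\Psi(r_2)$ for all $r_1,r_2\ge1$), and for any $\ell\in(\ell_0,\infty)$, $m\in(0,\infty)$ there is $C_{\ell,m}\in(0,1)$ with $\mathbb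 P_x(T^{(r)}<S_{(\ell)})\ge C_{\ell,m}/\Psi(r)$ for all $r\in(\ell+m,\infty)$ and $x\in\{V\ge\ell+m\}$, where $T^{(r)}=\inf\{n\in\mathbb N:V(X_n)>r\}$, $S_{(\ell)}=\inf\{n\in\mathbb N:V(X_n)<\ell\}$. For $k\in\mathbb N$ and $B\in\mathcal B(\mathcal X)$, $\tau_B(k)=\inf\{n\ge k:X_n\in B\}$, with $\inf\emptyset=\infty$.
   Formalization: For B ⊂ {V ≤ ℓ} the bound is shown for a suitable choice of the constants C_{ℓ,m} in L(ii); for an arbitrary admissible choice it is shown only when B ⊂ {V < ℓ}, since it can fail if B meets {V = ℓ}. *)

theory Defs
  imports "HOL-Probability.Probability"
begin

section \<open>Markov chains on a topological space\<close>

text \<open>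
  The chain is given by a transition kernel \<open>P\<close>, a coordinate process \<open>X\<close>, and for each starting
  point \<open>x\<close> the law \<open>Pr x\<close> on the sample space under which \<open>X\<close> starts at \<open>x\<close>. The sample space is
  arbitrary, not necessarily the canonical path space.
\<close>

definition history :: "(nat \<Rightarrow> 'w \<Rightarrow> 'a::topological_space) \<Rightarrow> 'w measure \<Rightarrow> nat \<Rightarrow> 'w measure" where
  "history X M n =
     vimage_algebra (space M) (\<lambda>\<omega>. \<lambda>i\<in>{..n}. X i \<omega>) (PiM {..n} (\<lambda>_. borel))"

text \<open>
  The starting condition says that \<open>X 0\<close> has law \<open>\<delta>\<^sub>x\<close>; in a space where points need not be
  measurable this is the meaning of ``started at \<open>x\<close>''.
\<close>

definition markov_chain ::
  "('a::topological_space \<Rightarrow> 'a measure) \<Rightarrow> ('a \<Rightarrow> 'w measure) \<Rightarrow> (nat \<Rightarrow> 'w \<Rightarrow> 'a) \<Rightarrow> bool" where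
  "markov_chain P Pr X \<longleftrightarrow>
     P \<in> borel \<rightarrow>\<^sub>M prob_algebra borel \<and>
     (\<forall>x. prob_space (Pr x) \<and>
          (\<forall>n. X n \<in> Pr x \<rightarrow>\<^sub>M borel) \<and>
          distr (Pr x) borel (X 0) = return borel x \<and>
          (\<forall>n. \<forall>A\<in>sets borel. AE \<omega> in Pr x.
             real_cond_exp (Pr x) (history X (Pr x) n) (\<lambda>\<omega>'. indicator A (X (Suc n) \<omega>')) \<omega>
               = measure (P (X n \<omega>)) A))"

definition step_law ::
  "('a::topological_space \<Rightarrow> 'w measure) \<Rightarrow> (nat \<Rightarrow> 'w \<Rightarrow> 'a) \<Rightarrow> nat \<Rightarrow> 'a \<Rightarrow> 'a measure" where
  "step_law Pr X n x = distr (Pr x) borel (X n)"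

definition feller ::
  "('a::topological_space \<Rightarrow> 'w measure) \<Rightarrow> (nat \<Rightarrow> 'w \<Rightarrow> 'a) \<Rightarrow> bool" where
  "feller Pr X \<longleftrightarrow>
     (\<forall>n U. open U \<longrightarrow> (\<forall>c. open {x. c < measure (step_law Pr X n x) U}))"

text \<open>
  Irreducibility, Harris recurrence, positivity and aperiodicity are understood as in Meyn and
  Tweedie, \<^emph>\<open>Markov Chains and Stochastic Stability\<close>.
\<close>

definition irreducibility_measure ::
  "('a::topological_space \<Rightarrow> 'w measure) \<Rightarrow> (nat \<Rightarrow> 'w \<Rightarrow> 'a) \<Rightarrow> 'a measure \<Rightarrow> bool" where
  "irreducibility_measure Pr X \<nu> \<longleftrightarrow>
     sets \<nu> = sets borel \<and> sigma_finite_measure \<nu> \<and> emeasure \<nu> UNIV \<noteq> 0 \<and>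
     (\<forall>A\<in>sets borel. 0 < emeasure \<nu> A \<longrightarrow> (\<forall>x. \<exists>n\<ge>1. 0 < measure (step_law Pr X n x) A))"

definition maximal_irreducibility_measure ::
  "('a::topological_space \<Rightarrow> 'w measure) \<Rightarrow> (nat \<Rightarrow> 'w \<Rightarrow> 'a) \<Rightarrow> 'a measure \<Rightarrow> bool" where
  "maximal_irreducibility_measure Pr X \<psi> \<longleftrightarrow>
     irreducibility_measure Pr X \<psi> \<and>
     (\<forall>\<nu>. irreducibility_measure Pr X \<nu> \<longrightarrow> absolutely_continuous \<psi> \<nu>)"

text \<open>\<open>\<psi>\<close> stands for a maximal irreducibility measure in the next two definitions.\<close>

definition harris_recurrent ::
  "('a::topological_space \<Rightarrow> 'w measure) \<Rightarrow> (nat \<Rightarrow> 'w \<Rightarrow> 'a) \<Rightarrow> 'a measure \<Rightarrow> bool" where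
  "harris_recurrent Pr X \<psi> \<longleftrightarrow>
     (\<forall>A\<in>sets borel. 0 < emeasure \<psi> A \<longrightarrow>
        (\<forall>x\<in>A. AE \<omega> in Pr x. \<exists>\<^sub>F n in sequentially. X n \<omega> \<in> A))"

text \<open>Aperiodicity: there is no \<open>d\<close>-cycle with \<open>d \<ge> 2\<close>.\<close>

definition aperiodic :: "('a::topological_space \<Rightarrow> 'a measure) \<Rightarrow> 'a measure \<Rightarrow> bool" where
  "aperiodic P \<psi> \<longleftrightarrow>
     \<not> (\<exists>d (D :: nat \<Rightarrow> 'a set). 2 \<le> d \<and>
          (\<forall>i<d. D i \<in> sets borel) \<and>
          disjoint_family_on D {..<d} \<and>
          (\<forall>i<d. \<forall>x\<in>D i. measure (P x) (D (Suc i mod d)) = 1) \<and>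
          emeasure \<psi> (- (\<Union>i<d. D i)) = 0)"

definition invariant_distribution ::
  "('a::topological_space \<Rightarrow> 'a measure) \<Rightarrow> 'a measure \<Rightarrow> bool" where
  "invariant_distribution P \<pi> \<longleftrightarrow>
     prob_space \<pi> \<and> sets \<pi> = sets borel \<and> \<pi> \<bind> P = \<pi>"

text \<open>
  Total variation distance of probability measures, normalised to take values in \<open>[0,1]\<close>; the
  other common normalisation differs by a factor 2, which does not affect convergence to 0.
\<close>

definition tv_dist :: "'a measure \<Rightarrow> 'a measure \<Rightarrow> real" where
  "tv_dist \<mu> \<nu> = (SUP A\<in>sets \<nu>. \<bar>measure \<mu> A - measure \<nu> A\<bar>)"

definition standing_assumptions ::
  "('a::topological_space \<Rightarrow> 'a measure) \<Rightarrow> ('a \<Rightarrow> 'w measure) \<Rightarrow> (nat \<Rightarrow> 'w \<Rightarrow> 'a) \<Rightarrow>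
   'a measure \<Rightarrow> bool" where
  "standing_assumptions P Pr X \<pi> \<longleftrightarrow>
     locally_compact_space (euclidean :: 'a topology) \<and>
     markov_chain P Pr X \<and>
     feller Pr X \<and>
     (\<exists>\<psi>. maximal_irreducibility_measure Pr X \<psi> \<and>
          harris_recurrent Pr X \<psi> \<and> aperiodic P \<psi>) \<and>
     invariant_distribution P \<pi> \<and>
     (\<forall>x. (\<lambda>n. tv_dist (step_law Pr X n x) \<pi>) \<longlonglongrightarrow> 0)"

section \<open>The assumption \<open>L(V, \<phi>, \<Psi>)\<close>\<close>

text \<open>\<open>hit_time X B k\<close> is \<open>\<tau>\<^sub>B(k)\<close>; recall that \<open>Inf {} = \<infinity>\<close> in \<^typ>\<open>enat\<close>.\<close>

definition hit_time :: "(nat \<Rightarrow> 'w \<Rightarrow> 'a) \<Rightarrow> 'a set \<Rightarrow> nat \<Rightarrow> 'w \<Rightarrow> enat" where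
  "hit_time X B k \<omega> = Inf {enat n | n. k \<le> n \<and> X n \<omega> \<in> B}"

definition exceed_time :: "(nat \<Rightarrow> 'w \<Rightarrow> 'a) \<Rightarrow> ('a \<Rightarrow> real) \<Rightarrow> real \<Rightarrow> 'w \<Rightarrow> enat" where
  "exceed_time X V r = hit_time X {y. V y > r} 0"

definition return_time :: "(nat \<Rightarrow> 'w \<Rightarrow> 'a) \<Rightarrow> ('a \<Rightarrow> real) \<Rightarrow> real \<Rightarrow> 'w \<Rightarrow> enat" where
  "return_time X V l = hit_time X {y. V y < l} 0"

definition escape_constant ::
  "('a \<Rightarrow> 'w measure) \<Rightarrow> (nat \<Rightarrow> 'w \<Rightarrow> 'a) \<Rightarrow> ('a \<Rightarrow> real) \<Rightarrow> (real \<Rightarrow> real) \<Rightarrow>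
   real \<Rightarrow> real \<Rightarrow> real \<Rightarrow> bool" where
  "escape_constant Pr X V \<Psi> l m c \<longleftrightarrow>
     0 < c \<and> c < 1 \<and>
     (\<forall>r>l + m. \<forall>x. l + m \<le> V x \<longrightarrow>
        \<P>(\<omega> in Pr x. exceed_time X V r \<omega> < return_time X V l \<omega>) \<ge> c / \<Psi> r)"

text \<open>
  Families \<open>(C\<^sub>l\<^sub>,\<^sub>m)\<close> of constants whose existence is required in part (ii). They are not unique,
  and the choice matters: the return time uses \<open>V < l\<close>, so an admissible constant says nothing
  about avoiding \<open>{V = l}\<close>. A bound for the hitting time of a set that meets \<open>{V = l}\<close> therefore
  holds for a suitable choice of the family, but not for every one.
\<close>

definition escape_constants ::
  "('a \<Rightarrow> 'w measure) \<Rightarrow> (nat \<Rightarrow> 'w \<Rightarrow> 'a) \<Rightarrow> ('a \<Rightarrow> real) \<Rightarrow> (real \<Rightarrow> real) \<Rightarrow> real \<Rightarrow>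
   (real \<Rightarrow> real \<Rightarrow> real) \<Rightarrow> bool" where
  "escape_constants Pr X V \<Psi> l0 C \<longleftrightarrow> (\<forall>l>l0. \<forall>m>0. escape_constant Pr X V \<Psi> l m (C l m))"

definition drift_condition ::
  "('a \<Rightarrow> 'a measure) \<Rightarrow> ('a \<Rightarrow> real) \<Rightarrow> (real \<Rightarrow> real) \<Rightarrow> real \<Rightarrow> bool" where
  "drift_condition P V \<phi> l0 \<longleftrightarrow>
     continuous_on {0<..1} \<phi> \<and>
     (\<forall>u\<in>{0<..1}. 0 \<le> \<phi> u) \<and>
     strict_antimono_on {1..} (\<lambda>r. r * \<phi> (1 / r)) \<and>
     ((\<lambda>r. r * \<phi> (1 / r)) \<longlongrightarrow> 0) at_top \<and>
     (\<exists>b\<ge>0. \<forall>x. (\<integral>y. 1 / V y \<partial>P x) - \<phi> (1 / V x) \<le> 1 / V x + b * indicator {y. V y \<le> l0} x)"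

definition escape_condition ::
  "('a \<Rightarrow> 'w measure) \<Rightarrow> (nat \<Rightarrow> 'w \<Rightarrow> 'a) \<Rightarrow> ('a \<Rightarrow> real) \<Rightarrow> (real \<Rightarrow> real) \<Rightarrow> real \<Rightarrow> bool" where
  "escape_condition Pr X V \<Psi> l0 \<longleftrightarrow>
     (\<forall>r\<ge>1. 1 \<le> \<Psi> r) \<and>
     \<Psi> differentiable_on {1..} \<and>
     mono_on {1..} \<Psi> \<and>
     (\<exists>K>0. \<forall>r\<ge>1. \<forall>s\<ge>1. \<Psi> (r + s) \<le> K * \<Psi> r * \<Psi> s) \<and>
     (\<exists>C. escape_constants Pr X V \<Psi> l0 C)"

definition assumption_L ::
  "('a::topological_space \<Rightarrow> 'a measure) \<Rightarrow> ('a \<Rightarrow> 'w measure) \<Rightarrow> (nat \<Rightarrow> 'w \<Rightarrow> 'a) \<Rightarrow>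
   ('a \<Rightarrow> real) \<Rightarrow> (real \<Rightarrow> real) \<Rightarrow> (real \<Rightarrow> real) \<Rightarrow> real \<Rightarrow> bool" where
  "assumption_L P Pr X V \<phi> \<Psi> l0 \<longleftrightarrow>
     continuous_on UNIV V \<and>
     (\<forall>x. 1 \<le> V x) \<and>
     (\<forall>x. AE \<omega> in Pr x. limsup (\<lambda>n. ereal (V (X n \<omega>))) = \<infinity>) \<and>
     1 \<le> l0 \<and>
     drift_condition P V \<phi> l0 \<and>
     escape_condition Pr X V \<Psi> l0"

section \<open>Additive functionals up to a return time\<close>

text \<open>
  Continuity is only asked on \<open>[l0', \<infinity>)\<close>; Borel measurability on \<open>[1, \<infinity>)\<close> (automatic when \<open>h\<close> is
  continuous there) is what makes the additive functional below a random variable.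
\<close>

definition admissible_weight :: "real \<Rightarrow> real \<Rightarrow> (real \<Rightarrow> real) \<Rightarrow> bool" where
  "admissible_weight l0 l0' h \<longleftrightarrow>
     l0 \<le> l0' \<and>
     (\<forall>r\<ge>1. 1 \<le> h r) \<and>
     h \<in> borel_measurable (restrict_space borel {1..}) \<and>
     continuous_on {l0'..} h \<and>
     mono_on {l0'..} h"

definition G_fun :: "real \<Rightarrow> (real \<Rightarrow> real) \<Rightarrow> (real \<Rightarrow> real) \<Rightarrow> real \<Rightarrow> real" where
  "G_fun q \<phi> h r = q * (1 - q) * h r / (r * \<phi> (1 / r))"

text \<open>The inverse of the restriction of \<open>G\<^sub>h\<close> to \<open>[l0', \<infinity>)\<close>.\<close>

definition G_inv :: "real \<Rightarrow> (real \<Rightarrow> real) \<Rightarrow> (real \<Rightarrow> real) \<Rightarrow> real \<Rightarrow> real \<Rightarrow> real" where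
  "G_inv q \<phi> h l0' = inv_into {l0'..} (G_fun q \<phi> h)"

text \<open>The sum of \<open>h (V (X k))\<close> over \<open>0 \<le> k \<le> \<tau>\<^sub>B(1)\<close>, an infinite series if \<open>\<tau>\<^sub>B(1) = \<infinity>\<close>.\<close>

definition additive_functional ::
  "(nat \<Rightarrow> 'w \<Rightarrow> 'a) \<Rightarrow> ('a \<Rightarrow> real) \<Rightarrow> (real \<Rightarrow> real) \<Rightarrow> 'a set \<Rightarrow> 'w \<Rightarrow> ennreal" where
  "additive_functional X V h B \<omega> =
     (\<Sum>k. if enat k \<le> hit_time X B 1 \<omega> then ennreal (h (V (X k \<omega>))) else 0)"

end

theory Submission
  imports Defs
begin

text \<open>
  The lower bound comes from a single scenario that makes the additive functional large. Put
  \<open>r0 = G_inv q \<phi> h l0' r\<close> and \<open>R = r0 / (1 - q)\<^sup>2\<close>, so that \<open>l + m < r0 < R\<close>. In its first step the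
  chain jumps to \<open>{V \<ge> l + m}\<close>; from there it passes the level \<open>R\<close> before it falls below \<open>l\<close>; after
  that it stays in \<open>{V \<ge> r0}\<close> for the next \<open>N = \<lfloor>q * (1 - q) / (r0 * \<phi> (1 / r0))\<rfloor>\<close> steps. The set \<open>B\<close>
  lies below \<open>l\<close> and is not met in the meantime, hence the sum contains \<open>N + 1\<close> terms of size
  at least \<open>h r0\<close>, and \<open>(N + 1) * h r0 \<ge> G_fun q \<phi> h r0 = r\<close>.

  The three stages have probabilities at least \<open>P x {V \<ge> l + m}\<close>, \<open>C l m / \<Psi> R\<close> (this is what the
  escape constant says) and \<open>q\<close>. The last one follows from the drift condition: while \<open>V \<ge> r0\<close>, the
  expectation of \<open>1 / V\<close> increases by at most \<open>\<phi> (1 / r0)\<close> per step. It starts below \<open>(1 - q)\<^sup>2 / r0\<close>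
  and has to exceed \<open>1 / r0\<close> at the moment of leaving \<open>{V \<ge> r0}\<close>, so leaving within \<open>N\<close> steps has
  probability at most \<open>(1 - q)\<^sup>2 + N * r0 * \<phi> (1 / r0) \<le> 1 - q\<close>; this is \<open>path_prob_stay_ge\<close>.

  Multiplying the three probabilities requires the Markov property at the random time of
  passing \<open>R\<close>. It is reduced to deterministic times: the event is the disjoint union, over the
  number \<open>n\<close> of steps spent between \<open>l\<close> and \<open>R\<close>, of cylinder events \<open>X\<^sub>1 \<in> A\<^sub>1, \<dots>, X\<^sub>k \<in> A\<^sub>k\<close>, and the
  probability of a cylinder event is an iterated integral of the kernel (\<open>emeasure_follows\<close>),
  for which the estimates are short inductions.

  This gives the claim for \<open>B \<subseteq> {V < l}\<close> and every choice of escape constants. For \<open>B \<subseteq> {V \<le> l}\<close>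
  it is applied with \<open>l + m / 2\<close> and \<open>m / 2\<close> in place of \<open>l\<close> and \<open>m\<close>, and \<open>escape_constant_shift\<close>
  shows that the constants obtained in this way are again admissible.
\<close>

section \<open>Iterated integrals of a transition kernel\<close>

text \<open>
  The probability that a chain with kernel \<open>P\<close> started at \<open>y\<close> is in the first set of the list at
  time 0, in the second one at time 1, and so on.
\<close>

fun path_prob :: "('a::topological_space \<Rightarrow> 'a measure) \<Rightarrow> 'a set list \<Rightarrow> 'a \<Rightarrow> ennreal" where
  "path_prob P [] y = 1"
| "path_prob P (A # As) y = indicator A y * (\<integral>\<^sup>+z. path_prob P As z \<partial>P y)"

lemma kernel_prob_space:
  fixes P :: "'a::topological_space \<Rightarrow> 'a measure"
  assumes "P \<in> borel \<rightarrow>\<^sub>M prob_algebra borel"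
  shows "prob_space (P y)" "sets (P y) = sets borel" "space (P y) = UNIV"
proof -
  show "prob_space (P y)" and s: "sets (P y) = sets borel"
    using measurable_space[OF assms, of y] by (auto simp: space_prob_algebra)
  show "space (P y) = UNIV" using sets_eq_imp_space_eq[OF s] by simp
qed

lemma kernel_measurable_nn_integral:
  fixes P :: "'a::topological_space \<Rightarrow> 'a measure"
  assumes P: "P \<in> borel \<rightarrow>\<^sub>M prob_algebra borel" and f: "f \<in> borel_measurable borel"
  shows "(\<lambda>y. \<integral>\<^sup>+z. f z \<partial>P y) \<in> borel_measurable borel"
  by (rule measurable_compose[OF measurable_prob_algebraD[OF P]
        nn_integral_measurable_subprob_algebra[OF f]])

lemma path_prob_measurable:
  fixes P :: "'a::topological_space \<Rightarrow> 'a measure"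
  assumes P: "P \<in> borel \<rightarrow>\<^sub>M prob_algebra borel" and "set As \<subseteq> sets borel"
  shows "path_prob P As \<in> borel_measurable borel"
  using assms(2)
proof (induction As)
  case (Cons A As)
  note [measurable] = kernel_measurable_nn_integral[OF P]
  from Cons have [measurable]: "path_prob P As \<in> borel_measurable borel" "A \<in> sets borel" by auto
  show ?case by (simp cong: measurable_cong_simp)
qed (simp cong: measurable_cong_simp)

lemma path_prob_singleton:
  assumes "P \<in> borel \<rightarrow>\<^sub>M prob_algebra borel"
  shows "path_prob P [U] y = indicator U y"
proof -
  interpret prob_space "P y" by (rule kernel_prob_space[OF assms])
  have "path_prob P [] = (\<lambda>_. 1)" by auto
  then have "(\<integral>\<^sup>+z. path_prob P [] z \<partial>P y) = 1" by (simp add: emeasure_space_1)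
  then show ?thesis by (simp only: path_prob.simps(2) mult_1_right)
qed

text \<open>
  The form of the strong Markov property that is needed: if after each visit to \<open>U\<close> the
  continuation \<open>Bs\<close> has probability at least \<open>q\<close>, then prolonging by \<open>Bs\<close> a path that ends in \<open>U\<close>
  costs at most a factor \<open>q\<close>.
\<close>

lemma path_prob_append_ge:
  assumes "\<And>z. z \<in> U \<Longrightarrow> q \<le> (\<integral>\<^sup>+y. path_prob P Bs y \<partial>P z)"
    and P: "P \<in> borel \<rightarrow>\<^sub>M prob_algebra borel" and "set As \<subseteq> sets borel" "U \<in> sets borel"
  shows "q * path_prob P (As @ [U]) y \<le> path_prob P (As @ U # Bs) y"
  using assms(3)
proof (induction As arbitrary: y)
  case Nil
  show ?case
    using assms(1)[of y] by (simp add: path_prob_singleton[OF P] indicator_def del: path_prob.simps)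
      (simp add: indicator_def)
next
  case (Cons A As)
  have [measurable]: "path_prob P (As @ [U]) \<in> borel_measurable borel"
    using Cons.prems assms by (intro path_prob_measurable) auto
  note [measurable_cong] = kernel_prob_space(2)[OF P, of y]
  have "q * (\<integral>\<^sup>+z. path_prob P (As @ [U]) z \<partial>P y) = (\<integral>\<^sup>+z. q * path_prob P (As @ [U]) z \<partial>P y)"
    by (subst nn_integral_cmult) auto
  also have "\<dots> \<le> (\<integral>\<^sup>+z. path_prob P (As @ U # Bs) z \<partial>P y)"
    using Cons by (intro nn_integral_mono) auto
  finally show ?case by (auto simp: indicator_def)
qed

section \<open>Cylinder events of the chain\<close>

lemma markov_chainD:
  assumes "markov_chain P Pr X"
  shows "P \<in> borel \<rightarrow>\<^sub>M prob_algebra borel" "prob_space (Pr x)" "X n \<in> Pr x \<rightarrow>\<^sub>M borel"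
    "distr (Pr x) borel (X 0) = return borel x"
    "A \<in> sets borel \<Longrightarrow> AE \<omega> in Pr x.
             real_cond_exp (Pr x) (history X (Pr x) n) (\<lambda>\<omega>'. indicator A (X (Suc n) \<omega>')) \<omega>
               = measure (P (X n \<omega>)) A"
  using assms unfolding markov_chain_def by auto

lemma space_history [simp]: "space (history X M n) = space M"
  by (simp add: history_def)

lemma history_measurable:
  assumes "i \<le> n" shows "X i \<in> history X M n \<rightarrow>\<^sub>M borel"
proof -
  have "(\<lambda>\<omega>. \<lambda>i\<in>{..n}. X i \<omega>) \<in> history X M n \<rightarrow>\<^sub>M PiM {..n} (\<lambda>_. borel)"
    unfolding history_def by (rule measurable_vimage_algebra1) (auto simp: space_PiM)
  from measurable_compose[OF this measurable_component_singleton[of i]] assms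
  show ?thesis by simp
qed

lemma history_leI:
  assumes "space N = space M" "\<And>i. i \<le> n \<Longrightarrow> X i \<in> N \<rightarrow>\<^sub>M borel"
  shows "sets (history X M n) \<subseteq> sets N"
proof -
  have "(\<lambda>\<omega>. \<lambda>i\<in>{..n}. X i \<omega>) \<in> N \<rightarrow>\<^sub>M PiM {..n} (\<lambda>_. borel)"
    using assms(2) by (intro measurable_restrict) auto
  then have "(\<lambda>\<omega>. \<omega>) \<in> N \<rightarrow>\<^sub>M history X M n"
    unfolding history_def by (intro measurable_vimage_algebra2) (auto simp: assms)
  then show ?thesis
    using assms(1) sets.sets_into_space[of _ "history X M n"]
    by (auto dest!: measurable_sets simp: Int_absorb2)
qed

lemma history_mono: "sets (history X M n) \<subseteq> sets (history X M (Suc n))"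
  by (rule history_leI) (auto intro: history_measurable)

text \<open>
  The defining property of the conditional expectation, integrated over an event of the past.
\<close>

lemma markov_step_set:
  assumes mc: "markov_chain P Pr X" and H: "H \<in> sets (history X (Pr x) n)" and A: "A \<in> sets borel"
  shows "(\<integral>\<^sup>+\<omega>. indicator H \<omega> * indicator A (X (Suc n) \<omega>) \<partial>Pr x) =
    (\<integral>\<^sup>+\<omega>. indicator H \<omega> * emeasure (P (X n \<omega>)) A \<partial>Pr x)"
proof -
  let ?M = "Pr x" and ?F = "history X (Pr x) n"
  interpret prob_space ?M by (rule markov_chainD[OF mc])
  note [measurable] = markov_chainD(3)[OF mc] A
  have sub: "subalgebra ?M ?F" 
    unfolding subalgebra_def using history_leI[of ?M ?M n X] markov_chainD(3)[OF mc] by simp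
  interpret finite_measure_subalgebra ?M ?F by unfold_locales (rule sub)
  have [measurable]: "H \<in> sets ?M" using sub H by (auto simp: subalgebra_def)
  have pm [measurable]: "(\<lambda>y. measure (P y) A) \<in> borel_measurable borel"
    using measurable_compose[OF measurable_prob_algebraD[OF markov_chainD(1)[OF mc]]
       measurable_measure_subprob_algebra[OF A]] by simp
  have p: "prob_space (P y)" for y by (rule kernel_prob_space[OF markov_chainD(1)[OF mc]])
  have 1: "measure (P y) A \<le> 1" for y by (rule prob_space.prob_le_1[OF p])
  have "(\<integral>\<^sup>+\<omega>. indicator H \<omega> * indicator A (X (Suc n) \<omega>) \<partial>?M)
     = (\<integral>\<^sup>+\<omega>. ennreal (indicator H \<omega> * indicator A (X (Suc n) \<omega>)) \<partial>?M)"
    by (intro nn_integral_cong) (auto simp: indicator_def)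
  also have "\<dots> = ennreal (\<integral>\<omega>. indicator H \<omega> * indicator A (X (Suc n) \<omega>) \<partial>?M)"
    by (intro nn_integral_eq_integral integrable_const_bound[where B=1])
      (auto simp: indicator_def)
  also have "(\<integral>\<omega>. indicator H \<omega> * indicator A (X (Suc n) \<omega>) \<partial>?M) =
     (\<integral>\<omega>. indicator H \<omega> * real_cond_exp ?M ?F (\<lambda>\<omega>'. indicator A (X (Suc n) \<omega>')) \<omega> \<partial>?M)"
    using real_cond_exp_intA[OF _ H, of "\<lambda>\<omega>'. indicator A (X (Suc n) \<omega>')"]
    by (simp add: set_lebesgue_integral_def integrable_const_bound[where B=1])
  also have "\<dots> = (\<integral>\<omega>. indicator H \<omega> * measure (P (X n \<omega>)) A \<partial>?M)"
    using markov_chainD(5)[OF mc A, of x n]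
    by (intro integral_cong_AE) auto
  also have "ennreal \<dots> = (\<integral>\<^sup>+\<omega>. ennreal (indicator H \<omega> * measure (P (X n \<omega>)) A) \<partial>?M)"
    using 1 by (intro nn_integral_eq_integral[symmetric] integrable_const_bound[where B=1])
      (auto simp: indicator_def)
  also have "\<dots> = (\<integral>\<^sup>+\<omega>. indicator H \<omega> * emeasure (P (X n \<omega>)) A \<partial>?M)"
    by (intro nn_integral_cong)
      (auto simp: indicator_def finite_measure.emeasure_eq_measure prob_space.finite_measure[OF p])
  finally show ?thesis .
qed

text \<open>
  The Markov property with a general function of the next state in place of an indicator,
  obtained by approximating it with simple functions.
\<close>

lemma markov_step:
  assumes mc: "markov_chain P Pr X" and H: "H \<in> sets (history X (Pr x) n)"
    and g: "g \<in> borel_measurable borel"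
  shows "(\<integral>\<^sup>+\<omega>. indicator H \<omega> * g (X (Suc n) \<omega>) \<partial>Pr x) =
    (\<integral>\<^sup>+\<omega>. indicator H \<omega> * (\<integral>\<^sup>+y. g y \<partial>P (X n \<omega>)) \<partial>Pr x)"
proof -
  let ?M = "Pr x"
  note P = markov_chainD(1)[OF mc]
  note [measurable] = markov_chainD(3)[OF mc] kernel_measurable_nn_integral[OF P]
  note [measurable_cong] = kernel_prob_space(2)[OF P]
  have [measurable]: "H \<in> sets ?M"
    using H history_leI[of "Pr x" "Pr x" n X] markov_chainD(3)[OF mc] by auto
  show ?thesis using g
  proof (induction rule: borel_measurable_induct)
    case (cong f g)
    then have "f = g" by auto
    with cong show ?case by simp
  next
    case (set A)
    then show ?case
      using markov_step_set[OF mc H] by (simp add: kernel_prob_space[OF P])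
  next
    case (mult u c)
    from mult(2) show ?case
      by (simp add: nn_integral_cmult mult.left_commute mult(4))
  next
    case (add u v)
    have [measurable]: "u \<in> borel_measurable borel" "v \<in> borel_measurable borel" by (fact add)+
    have "(\<integral>\<^sup>+y. v y + u y \<partial>P z) = (\<integral>\<^sup>+y. v y \<partial>P z) + (\<integral>\<^sup>+y. u y \<partial>P z)" for z
      by (rule nn_integral_add) auto
    then show ?case
      by (simp add: nn_integral_add distrib_left add.IH)
  next
    case (seq U)
    have [measurable]: "U i \<in> borel_measurable borel" for i by (rule seq)
    have inc: "incseq (\<lambda>i \<omega>. indicator H \<omega> * U i (X (Suc n) \<omega>))"
      "incseq (\<lambda>i \<omega>. indicator H \<omega> * (\<integral>\<^sup>+y. U i y \<partial>P (X n \<omega>)))"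
      using \<open>incseq U\<close>
      by (auto simp: incseq_def le_fun_def intro!: mult_left_mono nn_integral_mono)
    have "(\<integral>\<^sup>+\<omega>. indicator H \<omega> * (SUP i. U i) (X (Suc n) \<omega>) \<partial>?M)
      = (\<integral>\<^sup>+\<omega>. (SUP i. indicator H \<omega> * U i (X (Suc n) \<omega>)) \<partial>?M)"
      by (simp add: SUP_mult_left_ennreal image_comp)
    also have "\<dots> = (SUP i. \<integral>\<^sup>+\<omega>. indicator H \<omega> * U i (X (Suc n) \<omega>) \<partial>?M)"
      using inc by (intro nn_integral_monotone_convergence_SUP) auto
    also have "\<dots> = (SUP i. \<integral>\<^sup>+\<omega>. indicator H \<omega> * (\<integral>\<^sup>+y. U i y \<partial>P (X n \<omega>)) \<partial>?M)"
      by (simp add: seq)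
    also have "\<dots> = (\<integral>\<^sup>+\<omega>. (SUP i. indicator H \<omega> * (\<integral>\<^sup>+y. U i y \<partial>P (X n \<omega>))) \<partial>?M)"
      using inc by (intro nn_integral_monotone_convergence_SUP[symmetric]) auto
    also have "\<dots> = (\<integral>\<^sup>+\<omega>. indicator H \<omega> * (\<integral>\<^sup>+y. (SUP i. U i) y \<partial>P (X n \<omega>)) \<partial>?M)"
      using \<open>incseq U\<close>
      by (simp add: SUP_mult_left_ennreal[symmetric] nn_integral_monotone_convergence_SUP image_comp)
    finally show ?case .
  qed
qed

definition follows :: "(nat \<Rightarrow> 'w \<Rightarrow> 'a) \<Rightarrow> nat \<Rightarrow> 'a set list \<Rightarrow> 'w set" where
  "follows X n As = {\<omega>. \<forall>i<length As. X (n + i) \<omega> \<in> As ! i}"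

lemma follows_Cons:
  "follows X n (A # As) = {\<omega>. X n \<omega> \<in> A} \<inter> follows X (Suc n) As"
  unfolding follows_def by (auto simp: less_Suc_eq_0_disj nth_Cons' all_conj_distrib)

lemma follows_sets:
  assumes mc: "markov_chain P Pr X" and "set As \<subseteq> sets borel"
  shows "space (Pr x) \<inter> follows X n As \<in> sets (Pr x)"
  using assms(2)
proof (induction As arbitrary: n)
  case (Cons A As)
  have "space (Pr x) \<inter> follows X n (A # As) =
     (X n -` A \<inter> space (Pr x)) \<inter> (space (Pr x) \<inter> follows X (Suc n) As)"
    by (auto simp: follows_Cons)
  then show ?case using Cons markov_chainD(3)[OF mc, of n x] by (auto intro!: measurable_sets)
qed (simp add: follows_def)

text \<open>
  Induction on the list, with the event \<open>H\<close> of the past general: in the step the condition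
  \<open>X\<^sub>n \<in> A\<close> is absorbed into \<open>H\<close>, and the Markov property moves the rest of the path from time
  \<open>n + 1\<close> back to time \<open>n\<close>.
\<close>

lemma emeasure_follows:
  assumes mc: "markov_chain P Pr X" and "set As \<subseteq> sets borel" 
    and H: "H \<in> sets (history X (Pr x) n)"
  shows "emeasure (Pr x) (H \<inter> follows X n As) =
    (\<integral>\<^sup>+\<omega>. indicator H \<omega> * path_prob P As (X n \<omega>) \<partial>Pr x)"
  using assms(2,3)
proof (induction As arbitrary: n H)
  case Nil
  have "H \<in> sets (Pr x)"
    using Nil history_leI[of "Pr x" "Pr x" n X] markov_chainD(3)[OF mc] by auto
  then show ?case by (simp add: follows_def)
next
  case (Cons A As)
  let ?H = "H \<inter> (X n -` A \<inter> space (Pr x))"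
  have A: "?H \<in> sets (history X (Pr x) n)"
    using Cons.prems measurable_sets[OF history_measurable[of n n X "Pr x"], of A] by auto
  have "H \<subseteq> space (Pr x)" using sets.sets_into_space[OF Cons.prems(2)] by simp
  then have "H \<inter> follows X n (A # As) = ?H \<inter> follows X (Suc n) As"
    by (auto simp: follows_Cons)
  then have "emeasure (Pr x) (H \<inter> follows X n (A # As)) =
      (\<integral>\<^sup>+\<omega>. indicator ?H \<omega> * path_prob P As (X (Suc n) \<omega>) \<partial>Pr x)"
    using Cons A history_mono[of X "Pr x" n] by auto
  also have "\<dots> = (\<integral>\<^sup>+\<omega>. indicator ?H \<omega> * (\<integral>\<^sup>+y. path_prob P As y \<partial>P (X n \<omega>)) \<partial>Pr x)"
    using Cons.prems
    by (intro markov_step[OF mc A] path_prob_measurable markov_chainD(1)[OF mc]) auto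
  also have "\<dots> = (\<integral>\<^sup>+\<omega>. indicator H \<omega> * path_prob P (A # As) (X n \<omega>) \<partial>Pr x)"
    by (intro nn_integral_cong) (auto simp: indicator_def)
  finally show ?case .
qed

text \<open>
  The law of \<open>X 0\<close> is known only on Borel sets, which need not include \<open>{x}\<close>. It suffices that
  \<^const>\<open>path_prob\<close> is measurable and can be integrated against this law.
\<close>

lemma emeasure_follows_start:
  assumes mc: "markov_chain P Pr X" and As: "set As \<subseteq> sets borel"
  shows "emeasure (Pr x) (space (Pr x) \<inter> follows X 0 As) = path_prob P As x"
proof -
  have m: "path_prob P As \<in> borel_measurable borel"
    by (rule path_prob_measurable[OF markov_chainD(1)[OF mc] As])
  have "space (Pr x) \<in> sets (history X (Pr x) 0)"
    using sets.top[of "history X (Pr x) 0"] by simp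
  from emeasure_follows[OF mc As this]
  have "emeasure (Pr x) (space (Pr x) \<inter> follows X 0 As) = (\<integral>\<^sup>+\<omega>. path_prob P As (X 0 \<omega>) \<partial>Pr x)"
    by (auto intro!: nn_integral_cong)
  also have "\<dots> = (\<integral>\<^sup>+y. path_prob P As y \<partial>distr (Pr x) borel (X 0))"
    by (rule nn_integral_distr[symmetric]) (auto intro: markov_chainD(3)[OF mc] m)
  also have "\<dots> = path_prob P As x"
    using m by (simp add: markov_chainD(4)[OF mc] nn_integral_return)
  finally show ?thesis .
qed

lemma emeasure_follows_Suc_0:
  assumes mc: "markov_chain P Pr X" and As: "set As \<subseteq> sets borel"
  shows "emeasure (Pr x) (space (Pr x) \<inter> follows X 1 As) = (\<integral>\<^sup>+y. path_prob P As y \<partial>P x)"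
  using emeasure_follows_start[OF mc, of "UNIV # As" x] As by (simp add: follows_Cons)

section \<open>Staying above a level\<close>

lemma ennreal_integral_le_nn_integral:
  fixes f :: "'a \<Rightarrow> real"
  assumes "integrable M f"
  shows "ennreal (\<integral>x. f x \<partial>M) \<le> (\<integral>\<^sup>+x. ennreal (f x) \<partial>M)"
proof -
  have "ennreal (\<integral>x. f x \<partial>M) \<le> ennreal (\<integral>x. max 0 (f x) \<partial>M)"
    using assms by (intro ennreal_leI integral_mono) auto
  also have "\<dots> = (\<integral>\<^sup>+x. ennreal (max 0 (f x)) \<partial>M)"
    using assms by (intro nn_integral_eq_integral[symmetric]) auto
  also have "\<dots> = (\<integral>\<^sup>+x. ennreal (f x) \<partial>M)" by (simp add: ennreal_max_0)
  finally show ?thesis .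
qed

lemma scale_strict_antimono:
  assumes "drift_condition P V \<phi> l0" "1 \<le> r" "r < s"
  shows "s * \<phi> (1 / s) < r * \<phi> (1 / r)"
  using assms unfolding drift_condition_def by (auto dest!: monotone_onD[of _ _ _ _ r s])

lemma scale_pos:
  assumes "drift_condition P V \<phi> l0" "1 \<le> r"
  shows "0 < r * \<phi> (1 / r)"
proof -
  \<comment> \<open>A strictly decreasing function that is nonnegative at \<open>r + 1\<close> is positive at \<open>r\<close>.\<close>
  have "0 \<le> (r + 1) * \<phi> (1 / (r + 1))"
    using assms unfolding drift_condition_def by (intro mult_nonneg_nonneg) auto
  also have "\<dots> < r * \<phi> (1 / r)"
    using assms unfolding drift_condition_def by (auto dest!: monotone_onD[of _ _ _ _ r "r + 1"])
  finally show ?thesis .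
qed

lemma drift_above_level:
  assumes d: "drift_condition P V \<phi> l0" and "1 \<le> c" "l0 < c" "c \<le> V z"
  shows "(\<integral>y. 1 / V y \<partial>P z) \<le> 1 / V z + \<phi> (1 / c)"
proof -
  obtain b where "(\<integral>y. 1 / V y \<partial>P z) - \<phi> (1 / V z) \<le> 1 / V z + b * indicator {y. V y \<le> l0} z"
    using d unfolding drift_condition_def by auto
  then have "(\<integral>y. 1 / V y \<partial>P z) \<le> 1 / V z + \<phi> (1 / V z)" using assms by simp
  \<comment> \<open>\<open>\<phi>\<close> is increasing, being the product of \<open>u\<close> and \<open>\<phi> u / u\<close>, both increasing in \<open>u\<close>.\<close>
  also have "\<phi> (1 / V z) = (1 / V z) * (V z * \<phi> (1 / V z))" using assms by simp
  also have "\<dots> \<le> (1 / c) * (c * \<phi> (1 / c))"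
  proof (rule mult_mono)
    show "1 / V z \<le> 1 / c" using assms by (intro divide_left_mono) auto
    show "V z * \<phi> (1 / V z) \<le> c * \<phi> (1 / c)"
      using assms scale_strict_antimono[OF d, of c "V z"] by (cases "c = V z") auto
    show "0 \<le> 1 / c" "0 \<le> V z * \<phi> (1 / V z)"
      using assms scale_pos[OF d, of "V z"] by auto
  qed
  also have "\<dots> = \<phi> (1 / c)" using assms by simp
  finally show ?thesis by simp
qed

text \<open>
  A maximal inequality for \<open>1 / V\<close>. In place of stopping the process when it leaves \<open>{V \<ge> c}\<close>, the
  bound is stated for every starting point: it is trivial below \<open>c\<close>, and above \<open>c\<close> one step of the
  drift inequality reduces it to the bound for one step less.
\<close>

lemma path_prob_stay_ge:
  assumes P: "P \<in> borel \<rightarrow>\<^sub>M prob_algebra borel"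
    and V [measurable]: "V \<in> borel_measurable borel" and V1: "\<And>z. 1 \<le> V z"
    and c: "0 < c" and e: "0 \<le> e"
    and drift: "\<And>z. c \<le> V z \<Longrightarrow> (\<integral>y. 1 / V y \<partial>P z) \<le> 1 / V z + e"
  shows "ennreal (1 - c / V z - real N * (c * e)) \<le> path_prob P (replicate (Suc N) {y. c \<le> V y}) z"
proof (induction N arbitrary: z)
  case (0 z)
  \<comment> \<open>Below the level \<open>c\<close> the bound is negative, and \<^const>\<open>ennreal\<close> truncates it to 0.\<close>
  have "1 - c / V z \<le> 0" if "V z < c" using that V1[of z] by (simp add: field_simps)
  moreover have "1 - c / V z \<le> 1" using c V1[of z] by simp
  ultimately show ?case
    using path_prob_singleton[OF P, of "{y. c \<le> V y}" z]
    by (cases "c \<le> V z") (auto simp del: path_prob.simps simp: ennreal_neg)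
next
  case (Suc N z)
  let ?F = "{y. c \<le> V y}"
  show ?case
  proof (cases "c \<le> V z")
    case False
    then have "1 - c / V z \<le> 0" using V1[of z] by (simp add: field_simps)
    moreover have "0 \<le> real (Suc N) * (c * e)" using c e by simp
    ultimately show ?thesis by (simp add: ennreal_neg del: of_nat_Suc)
  next
    case True
    interpret prob_space "P z" by (rule kernel_prob_space[OF P])
    note [measurable_cong] = kernel_prob_space(2)[OF P, of z]
    have int: "integrable (P z) (\<lambda>y. 1 / V y)"
    proof (rule integrable_const_bound[where B=1])
      have "norm (1 / V y) \<le> 1" for y using V1[of y] by simp
      then show "AE y in P z. norm (1 / V y) \<le> 1" by simp
    qed measurable
    have "c * (\<integral>y. 1 / V y \<partial>P z) \<le> c * (1 / V z + e)"
      using drift[OF True] c by (intro mult_left_mono) auto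
    then have "1 - c / V z - real (Suc N) * (c * e) \<le> 1 - c * (\<integral>y. 1 / V y \<partial>P z) - real N * (c * e)"
      by (simp add: algebra_simps)
    also have "\<dots> = (\<integral>y. 1 - c * (1 / V y) - real N * (c * e) \<partial>P z)"
      using int by (simp add: prob_space del: times_divide_eq_right)
    finally have "ennreal (1 - c / V z - real (Suc N) * (c * e)) \<le>
        ennreal (\<integral>y. 1 - c * (1 / V y) - real N * (c * e) \<partial>P z)"
      by (rule ennreal_leI)
    also have "\<dots> \<le> (\<integral>\<^sup>+y. ennreal (1 - c * (1 / V y) - real N * (c * e)) \<partial>P z)"
      using int by (intro ennreal_integral_le_nn_integral) (auto simp del: times_divide_eq_right)
    also have "\<dots> \<le> (\<integral>\<^sup>+y. path_prob P (replicate (Suc N) ?F) y \<partial>P z)"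
      using Suc by (intro nn_integral_mono) simp
    also have "\<dots> = indicator ?F z * (\<integral>\<^sup>+y. path_prob P (replicate (Suc N) ?F) y \<partial>P z)"
      using True by (simp del: replicate_Suc)
    also have "\<dots> = path_prob P (replicate (Suc (Suc N)) ?F) z"
      by (simp only: replicate_Suc[of "Suc N"] path_prob.simps(2))
    finally show ?thesis .
  qed
qed

section \<open>The inverse of the growth function\<close>

lemma G_fun_strict_mono:
  assumes d: "drift_condition P V \<phi> l0" and h: "admissible_weight l0 l0' h"
    and "1 \<le> l0" "0 < q" "q < 1" "l0' \<le> s" "s < t"
  shows "G_fun q \<phi> h s < G_fun q \<phi> h t"
proof -
  have h: "l0 \<le> l0'" "1 \<le> h s" "h s \<le> h t"
    using assms unfolding admissible_weight_def by (auto dest: monotone_onD[of _ _ _ _ s t])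
  have "h s / (s * \<phi> (1 / s)) < h t / (t * \<phi> (1 / t))"
    using assms h scale_pos[OF d, of t] scale_strict_antimono[OF d, of s t]
    by (intro frac_less2) auto
  then have "(q * (1 - q)) * (h s / (s * \<phi> (1 / s))) < (q * (1 - q)) * (h t / (t * \<phi> (1 / t)))"
    using assms by (intro mult_strict_left_mono) auto
  then show ?thesis by (simp add: G_fun_def)
qed

lemma G_inv_props:
  assumes d: "drift_condition P V \<phi> l0" and h: "admissible_weight l0 l0' h"
    and l0: "1 \<le> l0" and q: "0 < q" "q < 1" and s: "l0' \<le> s" "G_fun q \<phi> h s < r"
  shows "s < G_inv q \<phi> h l0' r" "G_fun q \<phi> h (G_inv q \<phi> h l0' r) = r"
proof -
  have l: "l0 \<le> l0'" and h1: "\<And>r. 1 \<le> r \<Longrightarrow> 1 \<le> h r" and hc: "continuous_on {l0'..} h"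
    using h unfolding admissible_weight_def by auto
  have "0 < q * (1 - q) * h s" using h1[of s] s l l0 q by (intro mult_pos_pos) auto
  then have "0 < G_fun q \<phi> h s"
    unfolding G_fun_def using scale_pos[OF d, of s] s l l0 by (intro divide_pos_pos) auto
  then have r: "0 < r" using s by simp
  have "((\<lambda>r. r * \<phi> (1 / r)) \<longlongrightarrow> 0) at_top" using d by (simp add: drift_condition_def)
  \<comment> \<open>As \<open>h \<ge> 1\<close>, the function \<open>G_fun q \<phi> h\<close> is unbounded, so it takes the value \<open>r\<close> above \<open>s\<close>.\<close>
  then have "\<forall>\<^sub>F b in at_top. b * \<phi> (1 / b) < q * (1 - q) / r"
    by (rule order_tendstoD) (use q r in auto)
  with eventually_ge_at_top[of s] have "\<forall>\<^sub>F b in at_top. s \<le> b \<and> b * \<phi> (1 / b) < q * (1 - q) / r"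
    by eventually_elim auto
  then obtain b where b: "s \<le> b" "b * \<phi> (1 / b) < q * (1 - q) / r"
    by (auto simp: eventually_at_top_linorder)
  have "0 < b * \<phi> (1 / b)" "1 \<le> h b"
    using scale_pos[OF d, of b] h1[of b] b l l0 s by auto
  then have "r \<le> q * (1 - q) * 1 / (b * \<phi> (1 / b))"
    using b(2) r by (simp add: field_simps)
  also have "\<dots> \<le> G_fun q \<phi> h b"
    unfolding G_fun_def using \<open>0 < b * \<phi> (1 / b)\<close> \<open>1 \<le> h b\<close> q
    by (intro divide_right_mono mult_left_mono) auto
  finally have Gb: "r \<le> G_fun q \<phi> h b" .
  have "continuous_on {s..b} (G_fun q \<phi> h)"
    unfolding G_fun_def
  proof (intro continuous_intros)
    show "continuous_on {s..b} h" by (rule continuous_on_subset[OF hc]) (use s in auto)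
    show "continuous_on {s..b} (\<lambda>x. \<phi> (1 / x))"
      using d s l l0 unfolding drift_condition_def
      by (intro continuous_on_compose2[of "{0<..1}" \<phi> _ "\<lambda>x. 1 / x"] continuous_intros) auto
    show "\<forall>x\<in>{s..b}. x * \<phi> (1 / x) \<noteq> 0"
      using scale_pos[OF d] s l l0 by (metis atLeastAtMost_iff order.trans less_irrefl)
  qed
  from IVT'[OF _ Gb b(1) this, of ] s obtain t where "s \<le> t" "G_fun q \<phi> h t = r" by auto
  then have img: "r \<in> G_fun q \<phi> h ` {l0'..}" using s by auto
  show eq: "G_fun q \<phi> h (G_inv q \<phi> h l0' r) = r"
    unfolding G_inv_def by (rule f_inv_into_f[OF img])
  have ge: "l0' \<le> G_inv q \<phi> h l0' r"
    using inv_into_into[OF img] by (simp add: G_inv_def)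
  show "s < G_inv q \<phi> h l0' r"
  proof (rule ccontr)
    assume "\<not> ?thesis"
    then have "G_inv q \<phi> h l0' r = s \<or> G_inv q \<phi> h l0' r < s" by auto
    then have "G_fun q \<phi> h (G_inv q \<phi> h l0' r) \<le> G_fun q \<phi> h s"
      using G_fun_strict_mono[OF d h l0 q ge] by fastforce
    then show False using eq s by simp
  qed
qed

section \<open>Escape to high levels\<close>

text \<open>
  The number \<open>n\<close> of steps spent in \<open>E\<close> is the time of the first entry into \<open>U\<close>, hence it is
  determined by the path.
\<close>

lemma disjoint_first_entry:
  assumes "E \<inter> U = {}"
  shows "disjoint_family (\<lambda>n. S \<inter> follows X k (replicate n E @ U # Bs))"
proof -
  have *: "follows X k (replicate n E @ U # Bs) \<inter> follows X k (replicate n' E @ U # Bs) = {}"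
    if "n < n'" for n n'
  proof (intro equals0I)
    fix \<omega> assume "\<omega> \<in> follows X k (replicate n E @ U # Bs) \<inter> follows X k (replicate n' E @ U # Bs)"
    then have "X (k + n) \<omega> \<in> U" "X (k + n) \<omega> \<in> E"
      using that unfolding follows_def by (auto simp: nth_append dest!: spec[of _ n])
    then show False using assms by blast
  qed
  show ?thesis
    unfolding disjoint_family_on_def
  proof (intro ballI impI)
    fix m n :: nat assume "m \<noteq> n"
    then consider "m < n" | "n < m" by linarith
    then show "S \<inter> follows X k (replicate m E @ U # Bs) \<inter> (S \<inter> follows X k (replicate n E @ U # Bs)) = {}"
      by cases (use *[of m n] *[of n m] in blast)+
  qed
qed

lemma hit_time_ge_iff: "enat n \<le> hit_time X B k \<omega> \<longleftrightarrow> (\<forall>j. k \<le> j \<and> j < n \<longrightarrow> X j \<omega> \<notin> B)"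
  unfolding hit_time_def le_Inf_iff by (auto simp: not_less[symmetric])

lemma escape_event_eq:
  assumes "l \<le> r"
  shows "{\<omega>. exceed_time X V r \<omega> < return_time X V l \<omega>} =
    (\<Union>n. follows X 0 (replicate n {y. l \<le> V y \<and> V y \<le> r} @ [{y. r < V y}]))" (is "?L = ?R")
proof
  show "?L \<subseteq> ?R"
  proof
    fix \<omega> assume "\<omega> \<in> ?L"
    then have less: "exceed_time X V r \<omega> < return_time X V l \<omega>" by simp
    then obtain n where n: "exceed_time X V r \<omega> = enat n" by (cases "exceed_time X V r \<omega>") auto
    have "\<not> enat (Suc n) \<le> exceed_time X V r \<omega>" "enat n \<le> exceed_time X V r \<omega>"
      "enat (Suc n) \<le> return_time X V l \<omega>"
      using n less by (auto simp: Suc_ile_eq)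
    then have "\<forall>j<n. V (X j \<omega>) \<le> r" "\<exists>j<Suc n. r < V (X j \<omega>)" "\<forall>j<Suc n. l \<le> V (X j \<omega>)"
      unfolding exceed_time_def return_time_def hit_time_ge_iff by (auto simp: not_less)
    then have "\<omega> \<in> follows X 0 (replicate n {y. l \<le> V y \<and> V y \<le> r} @ [{y. r < V y}])"
      unfolding follows_def by (auto simp: nth_append less_Suc_eq)
    then show "\<omega> \<in> ?R" by blast
  qed
next
  show "?R \<subseteq> ?L"
  proof
    fix \<omega> assume "\<omega> \<in> ?R"
    then obtain n where
      f: "\<omega> \<in> follows X 0 (replicate n {y. l \<le> V y \<and> V y \<le> r} @ [{y. r < V y}])" by blast
    have a: "l \<le> V (X j \<omega>)" if "j < n" for j
      using f that unfolding follows_def by (auto simp: nth_append dest!: spec[of _ j])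
    have b: "r < V (X n \<omega>)"
      using f unfolding follows_def by (auto simp: nth_append dest!: spec[of _ n])
    have "enat (Suc n) \<le> return_time X V l \<omega>"
      unfolding return_time_def hit_time_ge_iff using a b assms by (fastforce simp: less_Suc_eq)
    moreover have "\<not> enat (Suc n) \<le> exceed_time X V r \<omega>"
      unfolding exceed_time_def hit_time_ge_iff using b by auto
    ultimately show "\<omega> \<in> ?L" by auto
  qed
qed

lemma escape_path_prob:
  assumes mc: "markov_chain P Pr X" and [measurable]: "V \<in> borel_measurable borel"
    and e: "escape_constant Pr X V \<Psi> l m c" and "0 < m" "l + m < r" "l + m \<le> V x"
  shows "ennreal (c / \<Psi> r) \<le> (\<Sum>n. path_prob P (replicate n {y. l \<le> V y \<and> V y \<le> r} @ [{y. r < V y}]) x)"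
proof -
  let ?A = "\<lambda>n. replicate n {y. l \<le> V y \<and> V y \<le> r} @ [{y. r < V y}]"
  interpret prob_space "Pr x" by (rule markov_chainD[OF mc])
  have As: "set (?A n) \<subseteq> sets borel" for n by (auto simp: set_replicate_conv_if)
  have "ennreal (c / \<Psi> r) \<le> \<P>(\<omega> in Pr x. exceed_time X V r \<omega> < return_time X V l \<omega>)"
    using e assms unfolding escape_constant_def by (intro ennreal_leI) auto
  also have "{\<omega> \<in> space (Pr x). exceed_time X V r \<omega> < return_time X V l \<omega>} =
      (\<Union>n. space (Pr x) \<inter> follows X 0 (?A n))"
    using escape_event_eq[of l r X V] assms by auto
  also have "ennreal (prob \<dots>) = emeasure (Pr x) \<dots>" by (simp add: emeasure_eq_measure)
  also have "\<dots> = (\<Sum>n. emeasure (Pr x) (space (Pr x) \<inter> follows X 0 (?A n)))"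
    using follows_sets[OF mc As]
    by (intro suminf_emeasure[symmetric] disjoint_first_entry) auto
  also have "\<dots> = (\<Sum>n. path_prob P (?A n) x)"
    by (simp only: emeasure_follows_start[OF mc As])
  finally show ?thesis .
qed

text \<open>
  Raising the lower level from \<open>l\<close> to \<open>l'\<close> makes the event in the definition of an escape constant
  smaller and, as \<open>l' + m' = l + m\<close>, leaves the starting points and the upper levels as they are.
\<close>

lemma escape_constant_shift:
  assumes mc: "markov_chain P Pr X" and [measurable]: "V \<in> borel_measurable borel"
    and e: "escape_constant Pr X V \<Psi> l' m' c" and "l \<le> l'" "l' + m' = l + m" "0 < m"
  shows "escape_constant Pr X V \<Psi> l m c"
  unfolding escape_constant_def
proof (intro conjI allI impI)
  show "0 < c" "c < 1" using e by (auto simp: escape_constant_def)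
  fix r x assume r: "l + m < r" and x: "l + m \<le> V x"
  interpret prob_space "Pr x" by (rule markov_chainD[OF mc])
  let ?A = "\<lambda>n. replicate n {y. l \<le> V y \<and> V y \<le> r} @ [{y. r < V y}]"
  have As: "set (?A n) \<subseteq> sets borel" for n by (auto simp: set_replicate_conv_if)
  have "c / \<Psi> r \<le> \<P>(\<omega> in Pr x. exceed_time X V r \<omega> < return_time X V l' \<omega>)"
    using e r x assms(5) unfolding escape_constant_def by auto
  also have "\<dots> \<le> \<P>(\<omega> in Pr x. exceed_time X V r \<omega> < return_time X V l \<omega>)"
  proof (rule finite_measure_mono)
    have "return_time X V l' \<omega> \<le> return_time X V l \<omega>" for \<omega>
      using assms(4) unfolding return_time_def hit_time_def by (intro Inf_superset_mono) auto
    then show "{\<omega> \<in> space (Pr x). exceed_time X V r \<omega> < return_time X V l' \<omega>}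
        \<subseteq> {\<omega> \<in> space (Pr x). exceed_time X V r \<omega> < return_time X V l \<omega>}"
      by (auto intro: order.strict_trans2)
    have eq: "{\<omega> \<in> space (Pr x). exceed_time X V r \<omega> < return_time X V l \<omega>} =
      (\<Union>n. space (Pr x) \<inter> follows X 0 (?A n))"
      using escape_event_eq[of l r X V] assms r by auto
    show "{\<omega> \<in> space (Pr x). exceed_time X V r \<omega> < return_time X V l \<omega>} \<in> events"
      unfolding eq using follows_sets[OF mc As] by (intro sets.countable_UN) auto
  qed
  finally show "c / \<Psi> r \<le> \<P>(\<omega> in Pr x. exceed_time X V r \<omega> < return_time X V l \<omega>)" .
qed

text \<open>
  The three stages of the excursion combined: the first step into \<open>D\<close>, the escape through \<open>E\<close>
  into \<open>U\<close>, and the continuation \<open>Bs\<close>. Summing over the duration \<open>n\<close> of the escape replaces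
  conditioning on a random time.
\<close>

lemma long_excursion_prob_ge:
  assumes mc: "markov_chain P Pr X" and "E \<inter> U = {}"
    and sets: "E \<in> sets borel" "U \<in> sets borel" "set Bs \<subseteq> sets borel" "D \<in> sets borel"
    and escape: "\<And>y. y \<in> D \<Longrightarrow> \<delta> \<le> (\<Sum>n. path_prob P (replicate n E @ [U]) y)"
    and stay: "\<And>z. z \<in> U \<Longrightarrow> q \<le> (\<integral>\<^sup>+y. path_prob P Bs y \<partial>P z)"
  shows "q * (\<delta> * emeasure (P x) D) \<le>
    emeasure (Pr x) (\<Union>n. space (Pr x) \<inter> follows X 1 (replicate n E @ U # Bs))"
proof -
  note P = markov_chainD(1)[OF mc]
  note [measurable_cong] = kernel_prob_space(2)[OF P, of x]
  have s1: "set (replicate n E @ [U]) \<subseteq> sets borel" and s2: "set (replicate n E @ U # Bs) \<subseteq> sets borel"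
    for n using sets by (auto simp: set_replicate_conv_if)
  note [measurable] = path_prob_measurable[OF P s1] path_prob_measurable[OF P s2] sets(4)
  have "\<delta> * emeasure (P x) D = (\<integral>\<^sup>+y. \<delta> * indicator D y \<partial>P x)"
    by (simp add: nn_integral_cmult_indicator)
  also have "\<dots> \<le> (\<integral>\<^sup>+y. (\<Sum>n. path_prob P (replicate n E @ [U]) y) \<partial>P x)"
    using escape by (intro nn_integral_mono) (auto simp: indicator_def)
  finally have "q * (\<delta> * emeasure (P x) D) \<le> q * (\<integral>\<^sup>+y. (\<Sum>n. path_prob P (replicate n E @ [U]) y) \<partial>P x)"
    by (rule mult_left_mono) simp
  also have "\<dots> = (\<integral>\<^sup>+y. (\<Sum>n. q * path_prob P (replicate n E @ [U]) y) \<partial>P x)"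
    by (simp add: nn_integral_cmult[symmetric] ennreal_suminf_cmult)
  also have "\<dots> \<le> (\<integral>\<^sup>+y. (\<Sum>n. path_prob P (replicate n E @ U # Bs) y) \<partial>P x)"
    using path_prob_append_ge[OF stay P] sets
    by (intro nn_integral_mono suminf_le) (auto simp: set_replicate_conv_if)
  also have "\<dots> = (\<Sum>n. \<integral>\<^sup>+y. path_prob P (replicate n E @ U # Bs) y \<partial>P x)"
    by (rule nn_integral_suminf) measurable
  also have "\<dots> = (\<Sum>n. emeasure (Pr x) (space (Pr x) \<inter> follows X 1 (replicate n E @ U # Bs)))"
    by (simp only: emeasure_follows_Suc_0[OF mc s2])
  also have "\<dots> = emeasure (Pr x) (\<Union>n. space (Pr x) \<inter> follows X 1 (replicate n E @ U # Bs))"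
    using follows_sets[OF mc s2] assms(2)
    by (intro suminf_emeasure disjoint_first_entry) auto
  finally show ?thesis .
qed

section \<open>The tail of the additive functional\<close>

lemma additive_functional_measurable:
  assumes X: "\<And>n. X n \<in> M \<rightarrow>\<^sub>M borel" and B: "B \<in> sets borel"
    and V: "V \<in> borel_measurable borel" "\<And>y. 1 \<le> V y"
    and h: "h \<in> borel_measurable (restrict_space borel {1..})"
  shows "additive_functional X V h B \<in> borel_measurable M"
proof -
  note [measurable] = X B
  have hit [measurable]: "Measurable.pred M (\<lambda>\<omega>. enat k \<le> hit_time X B 1 \<omega>)" for k
    unfolding hit_time_ge_iff by measurable
  have "V \<in> borel \<rightarrow>\<^sub>M restrict_space borel {1..}"
    using V by (intro measurable_restrict_space2) auto
  from measurable_compose[OF measurable_compose[OF X this] h]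
  have [measurable]: "(\<lambda>\<omega>. h (V (X k \<omega>))) \<in> borel_measurable M" for k .
  show ?thesis unfolding additive_functional_def[abs_def] by measurable
qed

text \<open>
  The return time counts from time 1, where the stretch \<open>As @ Bs\<close> starts. As this stretch avoids
  \<open>B\<close>, the return time comes after it, so all its terms enter the sum.
\<close>

lemma additive_functional_ge:
  assumes f: "\<omega> \<in> follows X 1 (As @ Bs)"
    and avoid: "\<And>A. A \<in> set (As @ Bs) \<Longrightarrow> A \<inter> B = {}"
    and large: "\<And>A y. A \<in> set Bs \<Longrightarrow> y \<in> A \<Longrightarrow> \<kappa> \<le> h (V y)"
  shows "of_nat (length Bs) * ennreal \<kappa> \<le> additive_functional X V h B \<omega>"
proof -
  let ?n = "length As" and ?m = "length Bs"
  let ?g = "\<lambda>k. if enat k \<le> hit_time X B 1 \<omega> then ennreal (h (V (X k \<omega>))) else 0"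
  have X: "X (Suc i) \<omega> \<in> (As @ Bs) ! i" if "i < ?n + ?m" for i
    using f that by (simp add: follows_def)
  have B: "X (Suc i) \<omega> \<notin> B" if "i < ?n + ?m" for i
    using X[OF that] avoid[of "(As @ Bs) ! i"] nth_mem[of i "As @ Bs"] that by auto
  have hit: "enat j \<le> hit_time X B 1 \<omega>" if "j \<le> ?n + ?m" for j
    unfolding hit_time_ge_iff using B that by (auto simp: Suc_le_eq gr0_conv_Suc)
  have "of_nat ?m * ennreal \<kappa> = (\<Sum>i<?m. ennreal \<kappa>)" by simp
  also have "\<dots> \<le> (\<Sum>i<?m. ?g (i + Suc ?n))"
  proof (intro sum_mono)
    fix i assume i: "i \<in> {..<?m}"
    have "X (i + Suc ?n) \<omega> \<in> Bs ! i" using X[of "?n + i"] i by (simp add: nth_append add.commute)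
    then show "ennreal \<kappa> \<le> ?g (i + Suc ?n)"
      using large[of "Bs ! i"] hit[of "i + Suc ?n"] i by (auto intro: ennreal_leI)
  qed
  also have "\<dots> = (\<Sum>k\<in>(\<lambda>i. i + Suc ?n) ` {..<?m}. ?g k)"
    by (rule sum.reindex[symmetric, unfolded comp_def]) (simp add: inj_on_def)
  also have "\<dots> \<le> additive_functional X V h B \<omega>"
    unfolding additive_functional_def by (rule sum_le_suminf) auto
  finally show ?thesis .
qed

lemma additive_functional_tail_ge:
  assumes mc: "markov_chain P Pr X" and L: "assumption_L P Pr X V \<phi> \<Psi> l0"
    and e: "escape_constant Pr X V \<Psi> l m c"
    and q: "0 < q" "q < 1" and h: "admissible_weight l0 l0' h" and l: "l0' \<le> l" "l0 < l"
    and B: "B \<in> sets borel" "B \<subseteq> {y. V y < l}" and m: "0 < m" and r: "G_fun q \<phi> h (l + m) < r"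
  shows "\<P>(\<omega> in Pr x. additive_functional X V h B \<omega> \<ge> ennreal r)
            \<ge> q * c * measure (P x) {y. V y \<ge> l + m} / \<Psi> (G_inv q \<phi> h l0' r / (1 - q)\<^sup>2)"
proof -
  interpret prob_space "Pr x" by (rule markov_chainD[OF mc])
  note P = markov_chainD(1)[OF mc]
  interpret P: prob_space "P x" by (rule kernel_prob_space[OF P])
  have V [measurable]: "V \<in> borel_measurable borel" and V1: "\<And>y. 1 \<le> V y" and l0: "1 \<le> l0"
    and d: "drift_condition P V \<phi> l0" and \<Psi>: "\<And>r. 1 \<le> r \<Longrightarrow> 1 \<le> \<Psi> r"
    using L unfolding assumption_L_def escape_condition_def
    by (auto intro: borel_measurable_continuous_onI)
  \<comment> \<open>The excursion has to pass \<open>R\<close> so that afterwards it stays above \<open>r0\<close> for \<open>N\<close> more steps with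
    probability \<open>q\<close>: the estimate for staying loses at most \<open>r0 / R = (1 - q)\<^sup>2\<close> initially and at most
    \<open>N * a \<le> q * (1 - q)\<close> over the \<open>N\<close> steps, which leaves \<open>1 - (1 - q)\<^sup>2 - q * (1 - q) = q\<close>.\<close>
  define r0 where "r0 = G_inv q \<phi> h l0' r"
  define R where "R = r0 / (1 - q)\<^sup>2"
  define a where "a = r0 * \<phi> (1 / r0)"
  define N where "N = nat \<lfloor>q * (1 - q) / a\<rfloor>"
  have r0: "l + m < r0" "G_fun q \<phi> h r0 = r"
    using G_inv_props[OF d h l0 q _ r] l m by (auto simp: r0_def)
  have hr0: "1 \<le> h r0" and hm: "\<And>v. r0 \<le> v \<Longrightarrow> h r0 \<le> h v"
    using h r0 l l0 m unfolding admissible_weight_def by (auto intro: mono_onD[of "{l0'..}" h])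
  have a: "0 < a" unfolding a_def using scale_pos[OF d, of r0] r0 l l0 m by auto
  have "(1 - q)\<^sup>2 < 1" using q by (simp add: power_less_one_iff abs_square_less_1)
  then have R: "r0 < R" unfolding R_def using q r0 l l0 m by (simp add: field_simps)
  have N: "real N \<le> q * (1 - q) / a" "q * (1 - q) / a \<le> real (Suc N)"
    using q a unfolding N_def by (auto simp: of_nat_nat) linarith
  let ?E = "{y. l \<le> V y \<and> V y \<le> R}" and ?U = "{y. R < V y}" and ?F = "{y. r0 \<le> V y}"
  let ?Bs = "replicate N ?F" and ?D = "{y. l + m \<le> V y}"
  have e0: "0 \<le> \<phi> (1 / r0)" using a r0 l l0 m unfolding a_def
    by (auto simp: zero_less_mult_iff)
  have stay: "ennreal q \<le> (\<integral>\<^sup>+y. path_prob P ?Bs y \<partial>P z)" if z: "z \<in> ?U" for z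
  proof -
    have "r0 / V z \<le> (1 - q)\<^sup>2"
      using z V1[of z] q unfolding R_def by (simp add: field_simps)
    moreover have "real N * (r0 * \<phi> (1 / r0)) \<le> q * (1 - q)"
      using N a by (simp add: field_simps a_def[symmetric])
    ultimately have "q \<le> 1 - r0 / V z - real N * (r0 * \<phi> (1 / r0))"
      by (simp add: power2_eq_square algebra_simps)
    then have "ennreal q \<le> ennreal (1 - r0 / V z - real N * (r0 * \<phi> (1 / r0)))"
      by (rule ennreal_leI)
    also have "\<dots> \<le> path_prob P (replicate (Suc N) ?F) z"
      using r0 l l0 m by (intro path_prob_stay_ge[OF P V V1 _ e0] drift_above_level[OF d]) auto
    also have "\<dots> = (\<integral>\<^sup>+y. path_prob P ?Bs y \<partial>P z)" using z R by simp
    finally show ?thesis .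
  qed
  have "ennreal q * (ennreal (c / \<Psi> R) * emeasure (P x) ?D) \<le>
      emeasure (Pr x) (\<Union>n. space (Pr x) \<inter> follows X 1 (replicate n ?E @ ?U # ?Bs))"
    using r0 R by (intro long_excursion_prob_ge[OF mc] escape_path_prob[OF mc V e m] stay)
      (auto simp: set_replicate_conv_if)
  also have "\<dots> \<le> emeasure (Pr x) {\<omega> \<in> space (Pr x). ennreal r \<le> additive_functional X V h B \<omega>}"
  proof (rule emeasure_mono)
    have "h \<in> borel_measurable (restrict_space borel {1..})"
      using h unfolding admissible_weight_def by simp
    then have [measurable]: "additive_functional X V h B \<in> borel_measurable (Pr x)"
      by (intro additive_functional_measurable markov_chainD(3)[OF mc] B(1) V V1)
    show "{\<omega> \<in> space (Pr x). ennreal r \<le> additive_functional X V h B \<omega>} \<in> events"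
      by measurable
    \<comment> \<open>The step that passes \<open>R\<close> is itself a visit above \<open>r0\<close>, so there are \<open>N + 1\<close> of them; this
      makes up for rounding \<open>q * (1 - q) / a\<close> down to \<open>N\<close>.\<close>
    have "r = q * (1 - q) / a * h r0" using r0(2) by (simp add: G_fun_def a_def)
    also have "\<dots> \<le> real (Suc N) * h r0" using N hr0 by (intro mult_right_mono) auto
    finally have "ennreal r \<le> ennreal (real (Suc N) * h r0)" by (rule ennreal_leI)
    also have "\<dots> = of_nat (length (?U # ?Bs)) * ennreal (h r0)"
      using hr0 by (simp add: ennreal_mult'' ennreal_of_nat_eq_real_of_nat)
    finally have r': "ennreal r \<le> of_nat (length (?U # ?Bs)) * ennreal (h r0)" .
    have "ennreal r \<le> additive_functional X V h B \<omega>"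
      if "\<omega> \<in> follows X 1 (replicate n ?E @ ?U # ?Bs)" for \<omega> n
    proof -
      have "V y < l" if "y \<in> B" for y using B(2) that by auto
      then show ?thesis
        using R r0(1) m that
        by (intro order.trans[OF r'] additive_functional_ge[where h = h and V = V] hm)
          (auto dest: less_imp_le, (force dest: order.strict_trans order.strict_trans2)+)
    qed
    then show "(\<Union>n. space (Pr x) \<inter> follows X 1 (replicate n ?E @ ?U # ?Bs)) \<subseteq>
        {\<omega> \<in> space (Pr x). ennreal r \<le> additive_functional X V h B \<omega>}" by blast
  qed
  finally have le: "ennreal q * (ennreal (c / \<Psi> R) * emeasure (P x) ?D) \<le>
      emeasure (Pr x) {\<omega> \<in> space (Pr x). ennreal r \<le> additive_functional X V h B \<omega>}" .
  have "0 < c" using e by (simp add: escape_constant_def)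
  moreover have "1 \<le> \<Psi> R" using \<Psi>[of R] R r0(1) l l0 m by simp
  ultimately have "ennreal (q * (c / \<Psi> R * measure (P x) ?D)) =
      ennreal q * (ennreal (c / \<Psi> R) * emeasure (P x) ?D)"
    using q by (simp add: P.emeasure_eq_measure ennreal_mult
        del: times_divide_eq_left times_divide_eq_right)
  with le have "ennreal (q * (c / \<Psi> R * measure (P x) ?D)) \<le>
      ennreal (\<P>(\<omega> in Pr x. ennreal r \<le> additive_functional X V h B \<omega>))"
    by (simp only: emeasure_eq_measure)
  then have "q * (c / \<Psi> R * measure (P x) ?D) \<le>
      \<P>(\<omega> in Pr x. ennreal r \<le> additive_functional X V h B \<omega>)"
    by (subst (asm) ennreal_le_iff) (rule measure_nonneg)
  then show ?thesis by (simp add: R_def r0_def mult.assoc)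
qed

theorem theorem2p2:
  fixes P :: "'a::topological_space \<Rightarrow> 'a measure"
    and Pr :: "'a \<Rightarrow> 'w measure"
    and X :: "nat \<Rightarrow> 'w \<Rightarrow> 'a"
    and \<pi> :: "'a measure"
    and V :: "'a \<Rightarrow> real"
    and \<phi> \<Psi> :: "real \<Rightarrow> real"
    and l0 :: real
  assumes "standing_assumptions P Pr X \<pi>"
    and "assumption_L P Pr X V \<phi> \<Psi> l0"
  shows
    "(\<exists>C. escape_constants Pr X V \<Psi> l0 C \<and>
       (\<forall>q h l0' l B m x r.
          0 < q \<and> q < 1 \<and> admissible_weight l0 l0' h \<and> l0' \<le> l \<and> l0 < l \<and>
          B \<in> sets borel \<and> B \<subseteq> {y. V y \<le> l} \<and> 0 < m \<and> G_fun q \<phi> h (l + m) < r \<longrightarrow>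
          \<P>(\<omega> in Pr x. additive_functional X V h B \<omega> \<ge> ennreal r)
            \<ge> q * C l m * measure (P x) {y. V y \<ge> l + m} / \<Psi> (G_inv q \<phi> h l0' r / (1 - q)\<^sup>2)))
     \<and>
     (\<forall>C. escape_constants Pr X V \<Psi> l0 C \<longrightarrow>
       (\<forall>q h l0' l B m x r.
          0 < q \<and> q < 1 \<and> admissible_weight l0 l0' h \<and> l0' \<le> l \<and> l0 < l \<and>
          B \<in> sets borel \<and> B \<subseteq> {y. V y < l} \<and> 0 < m \<and> G_fun q \<phi> h (l + m) < r \<longrightarrow>
          \<P>(\<omega> in Pr x. additive_functional X V h B \<omega> \<ge> ennreal r)
            \<ge> q * C l m * measure (P x) {y. V y \<ge> l + m} / \<Psi> (G_inv q \<phi> h l0' r / (1 - q)\<^sup>2)))"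
proof (intro conjI)
  have mc: "markov_chain P Pr X" using assms(1) by (simp add: standing_assumptions_def)
  have V: "V \<in> borel_measurable borel"
    using assms(2) unfolding assumption_L_def by (auto intro: borel_measurable_continuous_onI)
  obtain C0 where C0: "escape_constants Pr X V \<Psi> l0 C0"
    using assms(2) unfolding assumption_L_def escape_condition_def by auto
  \<comment> \<open>Splitting \<open>m\<close> in two halves leaves room between \<open>B\<close>, which may meet \<open>{V = l}\<close>, and the
    level \<open>l + m / 2\<close> that bounds the excursion from below.\<close>
  define C where "C = (\<lambda>l m. C0 (l + m / 2) (m / 2))"
  have e: "escape_constant Pr X V \<Psi> (l + m / 2) (m / 2) (C l m)" if "l0 < l" "0 < m" for l m
    using C0 that unfolding escape_constants_def C_def by auto
  have "escape_constants Pr X V \<Psi> l0 C"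
    unfolding escape_constants_def
    by (intro allI impI escape_constant_shift[OF mc V e]) auto
  moreover have "\<P>(\<omega> in Pr x. additive_functional X V h B \<omega> \<ge> ennreal r)
      \<ge> q * C l m * measure (P x) {y. V y \<ge> l + m} / \<Psi> (G_inv q \<phi> h l0' r / (1 - q)\<^sup>2)"
    if "0 < q \<and> q < 1 \<and> admissible_weight l0 l0' h \<and> l0' \<le> l \<and> l0 < l \<and>
      B \<in> sets borel \<and> B \<subseteq> {y. V y \<le> l} \<and> 0 < m \<and> G_fun q \<phi> h (l + m) < r"
    for q h l0' l B m x r
  proof -
    have "B \<subseteq> {y. V y < l + m / 2}" using that by force
    moreover have halves: "l + m / 2 + m / 2 = l + m" by simp
    ultimately show ?thesis
      using additive_functional_tail_ge[OF mc assms(2) e[of l m],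
          where q = q and l0' = l0' and h = h and B = B and r = r and x = x, unfolded halves] that
      by auto
  qed
  ultimately show "\<exists>C. escape_constants Pr X V \<Psi> l0 C \<and>
       (\<forall>q h l0' l B m x r.
          0 < q \<and> q < 1 \<and> admissible_weight l0 l0' h \<and> l0' \<le> l \<and> l0 < l \<and>
          B \<in> sets borel \<and> B \<subseteq> {y. V y \<le> l} \<and> 0 < m \<and> G_fun q \<phi> h (l + m) < r \<longrightarrow>
          \<P>(\<omega> in Pr x. additive_functional X V h B \<omega> \<ge> ennreal r)
            \<ge> q * C l m * measure (P x) {y. V y \<ge> l + m} / \<Psi> (G_inv q \<phi> h l0' r / (1 - q)\<^sup>2))"
    by blast
next
  have mc: "markov_chain P Pr X" using assms(1) by (simp add: standing_assumptions_def)
  show "\<forall>C. escape_constants Pr X V \<Psi> l0 C \<longrightarrow>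
       (\<forall>q h l0' l B m x r.
          0 < q \<and> q < 1 \<and> admissible_weight l0 l0' h \<and> l0' \<le> l \<and> l0 < l \<and>
          B \<in> sets borel \<and> B \<subseteq> {y. V y < l} \<and> 0 < m \<and> G_fun q \<phi> h (l + m) < r \<longrightarrow>
          \<P>(\<omega> in Pr x. additive_functional X V h B \<omega> \<ge> ennreal r)
            \<ge> q * C l m * measure (P x) {y. V y \<ge> l + m} / \<Psi> (G_inv q \<phi> h l0' r / (1 - q)\<^sup>2))"
    using additive_functional_tail_ge[OF mc assms(2)] unfolding escape_constants_def by blast
qed

end
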